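(* Let $X$ be a real Hilbert space, $L>0$, $A:X\to X$ monotone and $L$-Lipschitz continuous, and $B:X\rightrightarrows X$ maximal monotone. Let $0<\underline\lambda\le\bar\lambda<1/L$, let $(\lambda_k)_{k\ge1}$ be a sequence in $[\underline\lambda,\bar\lambda]$, let $x_0\in X$, and let $(x_k)$ be generated by Tseng's Modified Forward-Backward method $$y_k=(I+\lambda_kB)^{-1}\bigl(x_{k-1}-\lambda_kA(x_{k-1})\bigr),\qquad x_k=y_k-\lambda_k\bigl(A(y_k)-A(x_{k-1})\bigr),\qquad k=1,2,\dots$$ For $\lambda>0$ define $H_\lambda:X\to X\times X$, $H_\lambda(x)=\bigl(x,J_{\lambda B}(x-\lambda A(x))\bigr)$ and $G_\lambda:X\times X\to X$, $G_\lambda(x,y)=y-\lambda(A(y)-A(x))$, and let $\sigma=\bar\lambda L$. Then $0<\sigma<1$ and for any $x\in X$, $$G_{\lambda_k}\circ H_{\lambda_k}(x)\in J_{\lambda_k(A+B),\sigma}(x),\qquad k=1,2,\dots$$ In particular, $$x_k=G_{\lambda_k}\circ H_{\lambda_k}(x_{k-1})\in J_{\lambda_k(A+B),\sigma}(x_{k-1}),\qquad k=1,2,\dots,$$ and the sequence of maps $(G_{\lambda_k}\circ H_{\lambda_k})_{k\ge1}$ satisfies properties P1 and P2 with respect to $(A+B)^{-1}(0)$.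
   Context: $J_T=(I+T)^{-1}$ is the (single-valued, everywhere defined) resolvent of a maximal monotone operator $T$. For maximal monotone $T:X\rightrightarrows X$ (point-to-set) and $\varepsilon\ge 0$, $$T^{[\varepsilon]}(x)=\{v\in X : \langle x-y,v-u\rangle\ge-\varepsilon\ \text{ for all } y\in X,\ u\in T(y)\}.$$ For $\sigma\ge 0$, the $\sigma$-approximate resolvent of $T$ is the point-to-set map $$J_{T,\sigma}(x)=\{x-v : \exists\,\varepsilon\ge 0,\ y\in X \text{ with } v\in T^{[\varepsilon]}(y),\ \|v+y-x\|^2+2\varepsilon\le\sigma^2\|y-x\|^2\}.$$ Properties of a sequence $(F_n:X\rightrightarrows X)_{n\in\mathbb N}$ of point-to-set maps with respect to $\Omega\subset X$ (a single-valued map is identified with a singleton-valued point-to-set map): P1: if $\hat x\in F_n(x)$ (for some $n$ and $x\in X$) and $x^*\in\Omega$, then $\|x^*-\hat x\|\le\|x^*-x\|$. P2: if $(z_k)_{k\in\mathbb N}$ converges weakly to $\bar z$, $\hat z_k\in F_{n_k}(z_k)$ for all $k$ with $n_1<n_2<\cdots$, and for some $x^*\in\Omega$ one has $\lim_{k\to\infty}\left(\|x^*-z_k\|-\|x^*-\hat z_k\|\right)=0$, then $\bar z\in\Omega$. $(A+B)^{-1}(0)=\{x\in X : 0\in A(x)+B(x)\}$. *)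

theory Defs
  imports "HOL-Analysis.Analysis" "HOL-Library.Set_Algebras"
begin

text \<open>
  A point-to-set operator on a space \<open>'a\<close> is a function \<open>'a \<Rightarrow> 'a set\<close>.  Real Hilbert spaces
  are the types of sort \<open>{real_inner, complete_space}\<close>.
\<close>

definition op_of_map :: "('a \<Rightarrow> 'a) \<Rightarrow> 'a \<Rightarrow> 'a set" where
  "op_of_map f x = {f x}"

definition op_sum :: "('a::plus \<Rightarrow> 'a set) \<Rightarrow> ('a \<Rightarrow> 'a set) \<Rightarrow> 'a \<Rightarrow> 'a set" where
  "op_sum S T x = S x + T x"

definition op_scale :: "real \<Rightarrow> ('a::real_vector \<Rightarrow> 'a set) \<Rightarrow> 'a \<Rightarrow> 'a set" where
  "op_scale c T x = (\<lambda>v. c *\<^sub>R v) ` T x"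

definition op_inverse :: "('a \<Rightarrow> 'a set) \<Rightarrow> 'a \<Rightarrow> 'a set" where
  "op_inverse T x = {y. x \<in> T y}"

definition monotone_op :: "('a::real_inner \<Rightarrow> 'a set) \<Rightarrow> bool" where
  "monotone_op T \<longleftrightarrow>
     (\<forall>x y u v. u \<in> T x \<longrightarrow> v \<in> T y \<longrightarrow> 0 \<le> inner (x - y) (u - v))"

definition maximal_monotone :: "('a::real_inner \<Rightarrow> 'a set) \<Rightarrow> bool" where
  "maximal_monotone T \<longleftrightarrow>
     monotone_op T \<and> (\<forall>S. monotone_op S \<longrightarrow> (\<forall>x. T x \<subseteq> S x) \<longrightarrow> S = T)"

text \<open>
  The resolvent \<open>(I + T)\<inverse>\<close> as a function; for maximal monotone \<open>T\<close> on a Hilbert space the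
  value is determined by Minty's theorem, otherwise it may be unspecified.
\<close>

definition resolvent :: "('a::real_inner \<Rightarrow> 'a set) \<Rightarrow> 'a \<Rightarrow> 'a" where
  "resolvent T x = (THE y. y \<in> op_inverse (op_sum (op_of_map (\<lambda>z. z)) T) x)"

definition enlargement :: "real \<Rightarrow> ('a::real_inner \<Rightarrow> 'a set) \<Rightarrow> 'a \<Rightarrow> 'a set" where
  "enlargement \<epsilon> T x = {v. \<forall>y. \<forall>u\<in>T y. inner (x - y) (v - u) \<ge> - \<epsilon>}"

definition approx_resolvent :: "('a::real_inner \<Rightarrow> 'a set) \<Rightarrow> real \<Rightarrow> 'a \<Rightarrow> 'a set" where
  "approx_resolvent T \<sigma> x =
     {x - v | v. \<exists>\<epsilon>\<ge>0. \<exists>y. v \<in> enlargement \<epsilon> T y \<and>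
        (norm (v + y - x))\<^sup>2 + 2 * \<epsilon> \<le> \<sigma>\<^sup>2 * (norm (y - x))\<^sup>2}"

definition weakly_tendsto :: "(nat \<Rightarrow> 'a::real_normed_vector) \<Rightarrow> 'a \<Rightarrow> bool" where
  "weakly_tendsto z l \<longleftrightarrow>
     (\<forall>f :: 'a \<Rightarrow> real. bounded_linear f \<longrightarrow> (\<lambda>k. f (z k)) \<longlonglongrightarrow> f l)"

definition property_P1 :: "(nat \<Rightarrow> 'a::real_inner \<Rightarrow> 'a set) \<Rightarrow> 'a set \<Rightarrow> bool" where
  "property_P1 F \<Omega> \<longleftrightarrow>
     (\<forall>n x x' xs. x' \<in> F n x \<longrightarrow> xs \<in> \<Omega> \<longrightarrow> norm (xs - x') \<le> norm (xs - x))"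

definition property_P2 :: "(nat \<Rightarrow> 'a::real_inner \<Rightarrow> 'a set) \<Rightarrow> 'a set \<Rightarrow> bool" where
  "property_P2 F \<Omega> \<longleftrightarrow>
     (\<forall>z zbar z' n. weakly_tendsto z zbar \<longrightarrow> strict_mono n \<longrightarrow> (\<forall>k. z' k \<in> F (n k) (z k)) \<longrightarrow>
        (\<exists>xs\<in>\<Omega>. (\<lambda>k. norm (xs - z k) - norm (xs - z' k)) \<longlonglongrightarrow> 0) \<longrightarrow> zbar \<in> \<Omega>)"

definition tseng_H :: "('a::real_inner \<Rightarrow> 'a) \<Rightarrow> ('a \<Rightarrow> 'a set) \<Rightarrow> real \<Rightarrow> 'a \<Rightarrow> 'a \<times> 'a" where
  "tseng_H A B l x = (x, resolvent (op_scale l B) (x - l *\<^sub>R A x))"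

definition tseng_G :: "('a::real_inner \<Rightarrow> 'a) \<Rightarrow> real \<Rightarrow> 'a \<times> 'a \<Rightarrow> 'a" where
  "tseng_G A l = (\<lambda>(x, y). y - l *\<^sub>R (A y - A x))"

end

theory Submission
  imports Defs
begin

text \<open>
  With \<open>y = J\<^bsub>\<lambda>B\<^esub> (x - \<lambda> A x)\<close>, the vector \<open>v = x - y + \<lambda> (A y - A x)\<close> lies in \<open>\<lambda> (A + B) y\<close>, and
  \<open>v + y - x = \<lambda> (A y - A x)\<close> has norm at most \<open>\<lambda> L \<parallel>y - x\<parallel>\<close>: the Tseng step \<open>x - v\<close> is an
  approximate resolvent with \<open>\<epsilon> = 0\<close>.  Approximate resolvents of a maximal monotone operator have P1
  because \<open>\<parallel>x\<^sup>* - x\<parallel>\<^sup>2 - \<parallel>x\<^sup>* - x'\<parallel>\<^sup>2 \<ge> (1 - \<sigma>\<^sup>2) \<parallel>y - x\<parallel>\<^sup>2\<close>.  For P2, weakly convergent sequences are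
  bounded, so the same estimate forces \<open>y\<^sub>k - z\<^sub>k\<close>, \<open>v\<^sub>k\<close> and \<open>\<epsilon>\<^sub>k\<close> to \<open>0\<close>, and the defining
  inequality of the enlargement passes to the weak limit.  That the resolvent is defined everywhere
  is Minty's theorem, obtained by minimizing the Fitzpatrick function plus half the squared norm
  (Simons and Zalinescu).
\<close>

section \<open>Maximal monotone operators and their scalings\<close>

lemma monotone_opD:
  "monotone_op T \<Longrightarrow> u \<in> T x \<Longrightarrow> v \<in> T y \<Longrightarrow> 0 \<le> inner (x - y) (u - v)"
  unfolding monotone_op_def by blast

text \<open>Adjoining a pair monotonically related to the graph of \<open>T\<close> keeps the graph
  monotone, so maximality forces the pair to lie in it already. This one-point test is how
  maximality is proved and used below.\<close>

lemma maximal_monotone_iff: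
  "maximal_monotone T \<longleftrightarrow> monotone_op T \<and>
     (\<forall>x u. (\<forall>y. \<forall>v\<in>T y. 0 \<le> inner (x - y) (u - v)) \<longrightarrow> u \<in> T x)"
proof (intro iffI conjI allI impI)
  fix x u
  assume T: "maximal_monotone T" and rel: "\<forall>y. \<forall>v\<in>T y. 0 \<le> inner (x - y) (u - v)"
  define S where "S = T(x := insert u (T x))"
  have rel': "0 \<le> inner (y - x) (v - u)" if "v \<in> T y" for y v
    using rel that inner_minus_left[of "x - y" "u - v"] inner_minus_right[of "y - x" "u - v"] by fastforce
  have "monotone_op S"
    using T rel rel' unfolding monotone_op_def maximal_monotone_def S_def by (auto simp: fun_upd_def split: if_splits)
  moreover have "T y \<subseteq> S y" for y
    by (auto simp: S_def)
  ultimately have "S = T"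
    using T unfolding maximal_monotone_def by blast
  then show "u \<in> T x"
    by (metis S_def fun_upd_same insertI1)
next
  assume T: "monotone_op T \<and> (\<forall>x u. (\<forall>y. \<forall>v\<in>T y. 0 \<le> inner (x - y) (u - v)) \<longrightarrow> u \<in> T x)"
  have "S = T" if "monotone_op S" and sub: "\<And>x. T x \<subseteq> S x" for S
  proof (intro ext equalityI sub subsetI)
    fix x u assume "u \<in> S x"
    then have "\<forall>y. \<forall>v\<in>T y. 0 \<le> inner (x - y) (u - v)"
      using monotone_opD[OF \<open>monotone_op S\<close>] sub by blast
    then show "u \<in> T x" using T by blast
  qed
  then show "maximal_monotone T"
    using T unfolding maximal_monotone_def by blast
qed (auto simp: maximal_monotone_def)

lemma maximal_monotoneD:
  "maximal_monotone T \<Longrightarrow> (\<And>y v. v \<in> T y \<Longrightarrow> 0 \<le> inner (x - y) (u - v)) \<Longrightarrow> u \<in> T x"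
  unfolding maximal_monotone_iff by blast

lemma maximal_monotone_imp_monotone: "maximal_monotone T \<Longrightarrow> monotone_op T"
  unfolding maximal_monotone_def by blast

lemma maximal_monotone_op_scale:
  assumes "maximal_monotone T" "0 < c"
  shows "maximal_monotone (op_scale c T)"
  unfolding maximal_monotone_iff
proof (intro conjI allI impI)
  have "0 \<le> inner (x - y) (c *\<^sub>R u - c *\<^sub>R v)" if "u \<in> T x" "v \<in> T y" for x y u v
    using monotone_opD[OF maximal_monotone_imp_monotone[OF assms(1)] that] assms(2)
    by (metis inner_scaleR_right less_imp_le mult_nonneg_nonneg scaleR_diff_right)
  then show "monotone_op (op_scale c T)"
    unfolding monotone_op_def op_scale_def by auto
next
  fix x u
  assume rel: "\<forall>y. \<forall>v\<in>op_scale c T y. 0 \<le> inner (x - y) (u - v)"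
  have "u /\<^sub>R c \<in> T x"
  proof (rule maximal_monotoneD[OF assms(1)])
    fix y v assume "v \<in> T y"
    then have "0 \<le> inner (x - y) (u - c *\<^sub>R v)"
      using rel by (auto simp: op_scale_def)
    also have "u - c *\<^sub>R v = c *\<^sub>R (u /\<^sub>R c - v)"
      using assms(2) by (simp add: scaleR_diff_right)
    finally show "0 \<le> inner (x - y) (u /\<^sub>R c - v)"
      using assms(2) by (simp add: zero_le_mult_iff)
  qed
  then show "u \<in> op_scale c T x"
    unfolding op_scale_def using assms(2) by (auto intro: image_eqI[where x = "u /\<^sub>R c"])
qed

section \<open>Minty's theorem\<close>

text \<open>By the parallelogram law, minimizing sequences of \<open>r + \<parallel>z\<parallel>\<^sup>2 / 2\<close> are Cauchy.\<close>

lemma epigraph_regularized_minimizer: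
  fixes C :: "('b::{real_inner, complete_space} \<times> real) set"
  assumes "closed C" "convex C" "C \<noteq> {}"
    and lower: "\<And>z r. (z, r) \<in> C \<Longrightarrow> 0 \<le> r + (norm z)\<^sup>2 / 2"
  obtains p r where "(p, r) \<in> C" "\<And>z s. (z, s) \<in> C \<Longrightarrow> 0 \<le> s - r + inner p (z - p)"
proof -
  define f where "f q = snd q + (norm (fst q))\<^sup>2 / 2" for q :: "'b \<times> real"
  define m where "m = Inf (f ` C)"
  have bdd: "bdd_below (f ` C)"
    using lower by (force simp: f_def intro!: bdd_belowI[where m = 0])
  have m_le: "m \<le> f q" if "q \<in> C" for q
    unfolding m_def using that by (intro cInf_lower bdd) auto
  have "\<exists>q\<in>C. f q < m + inverse (real (Suc n))" for n
    using cInf_lessD[of "f ` C" "m + inverse (real (Suc n))"] assms(3) unfolding m_def by auto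
  then obtain q where q: "\<And>n. q n \<in> C" and fq: "\<And>n. f (q n) < m + inverse (real (Suc n))"
    by metis
  have dist_le: "(dist (fst (q i)) (fst (q j)))\<^sup>2 \<le> 4 * (inverse (real (Suc i)) + inverse (real (Suc j)))" for i j
  proof -
    \<comment> \<open>Convexity puts the midpoint in \<open>C\<close>, so its value is at least the
      infimum \<open>m\<close>; the parallelogram law turns this into a bound on the
      distance.\<close>
    have "(1/2) *\<^sub>R q i + (1/2) *\<^sub>R q j \<in> C"
      using convexD[OF assms(2) q q, of "1/2" "1/2"] by simp
    from m_le[OF this]
    have "m \<le> (snd (q i) + snd (q j)) / 2 + (norm ((1/2) *\<^sub>R (fst (q i) + fst (q j))))\<^sup>2 / 2"
      by (simp add: f_def scaleR_add_right add_divide_distrib)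
    then have "8 * m \<le> 4 * (snd (q i) + snd (q j)) + (norm (fst (q i) + fst (q j)))\<^sup>2"
      unfolding norm_scaleR power_mult_distrib by (simp add: field_simps)
    moreover have "(norm (fst (q i) + fst (q j)))\<^sup>2 + (dist (fst (q i)) (fst (q j)))\<^sup>2
        = 2 * (norm (fst (q i)))\<^sup>2 + 2 * (norm (fst (q j)))\<^sup>2"
      by (simp add: dist_norm power2_norm_eq_inner algebra_simps)
    ultimately show ?thesis
      using fq[of i] fq[of j] by (simp add: f_def)
  qed
  have "Cauchy (\<lambda>n. fst (q n))"
  proof (rule metric_CauchyI)
    fix e :: real assume "0 < e"
    \<comment> \<open>Two inverses below \<open>e\<^sup>2 / 8\<close>, times the factor 4 in
      \<open>dist_le\<close>, add up to less than \<open>e\<^sup>2\<close>.\<close>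
    then have "0 < e\<^sup>2 / 8" by simp
    then obtain N where N: "inverse (real (Suc N)) < e\<^sup>2 / 8"
      using reals_Archimedean by blast
    have "dist (fst (q i)) (fst (q j)) < e" if "N \<le> i" "N \<le> j" for i j
    proof -
      have "inverse (real (Suc i)) \<le> inverse (real (Suc N))" "inverse (real (Suc j)) \<le> inverse (real (Suc N))"
        using that by (auto intro!: le_imp_inverse_le)
      then have "(dist (fst (q i)) (fst (q j)))\<^sup>2 < e\<^sup>2"
        using dist_le[of i j] N by argo
      then show ?thesis
        using \<open>0 < e\<close> by (simp add: power2_less_imp_less)
    qed
    then show "\<exists>N. \<forall>i\<ge>N. \<forall>j\<ge>N. dist (fst (q i)) (fst (q j)) < e" by blast
  qed
  then obtain p where p: "(\<lambda>n. fst (q n)) \<longlonglongrightarrow> p"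
    using Cauchy_convergent convergent_def by blast
  have "(\<lambda>n. f (q n)) \<longlonglongrightarrow> m"
  proof (rule tendsto_sandwich[OF always_eventually always_eventually tendsto_const])
    show "(\<lambda>n. m + inverse (real (Suc n))) \<longlonglongrightarrow> m"
      using LIMSEQ_inverse_real_of_nat_add by blast
  qed (use m_le[OF q] less_imp_le[OF fq] in blast)+
  \<comment> \<open>Convergence of the heights comes from that of the values \<open>f (q n)\<close>
    and of the norms, since \<open>snd\<close> is their difference.\<close>
  then have "(\<lambda>n. f (q n) - (norm (fst (q n)))\<^sup>2 / 2) \<longlonglongrightarrow> m - (norm p)\<^sup>2 / 2"
    by (intro tendsto_intros p) auto
  then have "(\<lambda>n. snd (q n)) \<longlonglongrightarrow> m - (norm p)\<^sup>2 / 2"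
    by (simp add: f_def)
  define r where "r = m - (norm p)\<^sup>2 / 2"
  have "q \<longlonglongrightarrow> (p, r)"
    using tendsto_Pair[OF p \<open>(\<lambda>n. snd (q n)) \<longlonglongrightarrow> _\<close>] by (simp add: r_def)
  then have pr: "(p, r) \<in> C"
    using closed_sequentially[OF assms(1)] q by blast
  \<comment> \<open>First-order optimality: compare \<open>(p, r)\<close> with points of the segment
    towards \<open>(z, s)\<close>, divide by the parameter \<open>t\<close> and let \<open>t\<close>
    tend to 0.\<close>
  moreover have "0 \<le> s - r + inner p (z - p)" if zs: "(z, s) \<in> C" for z s
  proof (rule tendsto_lowerbound)
    have "((\<lambda>t. s - r + inner p (z - p) + t / 2 * (norm (z - p))\<^sup>2)
        \<longlongrightarrow> s - r + inner p (z - p) + 0 / 2 * (norm (z - p))\<^sup>2) (at_right 0)"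
      by (intro tendsto_intros) auto
    then show "((\<lambda>t. s - r + inner p (z - p) + t / 2 * (norm (z - p))\<^sup>2)
        \<longlongrightarrow> s - r + inner p (z - p)) (at_right 0)"
      by simp
    have "0 \<le> s - r + inner p (z - p) + t / 2 * (norm (z - p))\<^sup>2" if "0 < t" "t < 1" for t
    proof -
      have "(1 - t) *\<^sub>R (p, r) + t *\<^sub>R (z, s) \<in> C"
        using that by (intro convexD[OF assms(2) pr zs]) auto
      from m_le[OF this] have "r + (norm p)\<^sup>2 / 2
          \<le> (1 - t) * r + t * s + (norm ((1 - t) *\<^sub>R p + t *\<^sub>R z))\<^sup>2 / 2"
        by (simp add: f_def r_def)
      also have "\<dots> = r + (norm p)\<^sup>2 / 2 + t * (s - r + inner p (z - p) + t / 2 * (norm (z - p))\<^sup>2)"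
        unfolding power2_norm_eq_inner
        by (simp add: algebra_simps inner_commute[of z p]) (simp add: field_simps power2_eq_square)
      finally show ?thesis
        using \<open>0 < t\<close> by (simp add: zero_le_mult_iff)
    qed
    then show "\<forall>\<^sub>F t in at_right 0. 0 \<le> s - r + inner p (z - p) + t / 2 * (norm (z - p))\<^sup>2"
      unfolding eventually_at_right[OF zero_less_one] using zero_less_one by blast
  qed simp
  ultimately show ?thesis using that by blast
qed

text \<open>
  The set \<open>C\<close> is the epigraph of the Fitzpatrick function
  \<open>(x, u) \<mapsto> SUP v\<in>T y. \<langle>x, v\<rangle> + \<langle>y, u\<rangle> - \<langle>y, v\<rangle>\<close>; by maximality it lies above the duality pairing.
\<close>

lemma Minty_zero:
  fixes T :: "'a::{real_inner, complete_space} \<Rightarrow> 'a set"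
  assumes T: "maximal_monotone T"
  shows "\<exists>x. - x \<in> T x"
proof -
  define C :: "(('a \<times> 'a) \<times> real) set" where
    "C = {((x, u), r) |x u r. \<forall>y. \<forall>v\<in>T y. inner x v + inner y u - inner y v \<le> r}"
  \<comment> \<open>As an intersection of closed half-spaces indexed by the graph of
    \<open>T\<close>, \<open>C\<close> is closed and convex.\<close>
  have C_eq: "C = (\<Inter>y. \<Inter>v\<in>T y. {q. inner (fst (fst q)) v + inner y (snd (fst q)) - inner y v \<le> snd q})"
    by (force simp: C_def)
  have "closed C"
    unfolding C_eq by (intro closed_INT ballI closed_Collect_le continuous_intros)
  moreover have "convex C"
    unfolding C_eq
  proof (intro convex_INT)
    fix y v
    have "{q :: ('a \<times> 'a) \<times> real. inner (fst (fst q)) v + inner y (snd (fst q)) - inner y v \<le> snd q}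
        = {q. inner ((v, y), - 1) q \<le> inner y v}"
      by (auto simp: inner_prod_def inner_commute)
    then show "convex {q :: ('a \<times> 'a) \<times> real. inner (fst (fst q)) v + inner y (snd (fst q)) - inner y v \<le> snd q}"
      by (simp add: convex_halfspace_le)
  qed
  moreover have graph_C: "((a, b), inner a b) \<in> C" if "b \<in> T a" for a b
    unfolding C_def using monotone_opD[OF maximal_monotone_imp_monotone[OF T] that]
    by (fastforce simp: inner_diff_left inner_diff_right)
  \<comment> \<open>The graph of \<open>T\<close> is nonempty: otherwise the test for
    \<open>0\<close> in \<open>T 0\<close> would hold vacuously.\<close>
  moreover have "C \<noteq> {}"
    using maximal_monotoneD[OF T, of 0 0] graph_C by fastforce
  \<comment> \<open>If \<open>r\<close> were below \<open>inner x u\<close>, then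
    \<open>inner (x - y) (u - v)\<close> would be positive on the graph, putting \<open>u\<close> in
    \<open>T x\<close>; the constraint of \<open>C\<close> at that very pair then gives a
    contradiction.\<close>
  moreover have pairing_le: "inner x u \<le> r" if C: "((x, u), r) \<in> C" for x u r
  proof (rule ccontr)
    assume less: "\<not> inner x u \<le> r"
    have C': "inner x v + inner y u - inner y v \<le> r" if "v \<in> T y" for y v
      using C that by (auto simp: C_def)
    have "u \<in> T x"
    proof (rule maximal_monotoneD[OF T])
      fix y v assume "v \<in> T y"
      then show "0 \<le> inner (x - y) (u - v)"
        using C'[of v y] less by (simp add: inner_diff_left inner_diff_right)
    qed
    then show False
      using C'[of u x] less by simp
  qed
  moreover have "0 \<le> r + (norm z)\<^sup>2 / 2" if "(z, r) \<in> C" for z r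
  proof -
    obtain x u where z: "z = (x, u)" by force
    have "0 \<le> (norm (x + u))\<^sup>2" by simp
    also have "\<dots> = 2 * inner x u + (norm z)\<^sup>2"
      unfolding power2_norm_eq_inner by (simp add: z algebra_simps inner_commute)
    finally show ?thesis
      using pairing_le that z by fastforce
  qed
  ultimately obtain p r where pr: "(p, r) \<in> C"
    and min: "\<And>z s. (z, s) \<in> C \<Longrightarrow> 0 \<le> s - r + inner p (z - p)"
    using epigraph_regularized_minimizer[of C] by blast
  obtain x u where p: "p = (x, u)" by force
  \<comment> \<open>Optimality at the graph point \<open>((a, b), inner a b)\<close>, with
    \<open>r\<close> replaced by its lower bound \<open>inner x u\<close>; adding
    \<open>inner u x\<close> completes the square and factors the other side.\<close>
  have rel: "(norm (x + u))\<^sup>2 \<le> inner (- u - a) (- x - b)" if "b \<in> T a" for a b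
    using min[OF graph_C[OF that]] pairing_le[OF pr[unfolded p]] unfolding p power2_norm_eq_inner
    by (simp add: inner_diff_left inner_diff_right inner_add_left inner_add_right inner_commute)
  have "- x \<in> T (- u)"
    using rel zero_le_power2 order_trans by (blast intro: maximal_monotoneD[OF T])
  \<comment> \<open>At the graph point \<open>(- u, - x)\<close> itself the right side of
    \<open>rel\<close> vanishes.\<close>
  then have "x + u = 0"
    using rel[of "- x" "- u"] by simp
  then have "x = - u"
    by (simp add: eq_neg_iff_add_eq_0)
  then show ?thesis
    using \<open>- x \<in> T (- u)\<close> by (metis minus_minus)
qed

text \<open>Subtracting \<open>w\<close> from all values of \<open>T\<close> preserves maximal
  monotonicity, so \<open>Minty_zero\<close> applies to the translate.\<close>

theorem Minty:
  fixes T :: "'a::{real_inner, complete_space} \<Rightarrow> 'a set"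
  assumes T: "maximal_monotone T"
  shows "\<exists>x. w - x \<in> T x"
proof -
  have "maximal_monotone (\<lambda>x. {v. v + w \<in> T x})"
    unfolding maximal_monotone_iff
  proof (intro conjI allI impI)
    show "monotone_op (\<lambda>x. {v. v + w \<in> T x})"
      unfolding monotone_op_def
      using monotone_opD[OF maximal_monotone_imp_monotone[OF T]] by fastforce
    fix x u
    assume rel: "\<forall>y. \<forall>v\<in>{v. v + w \<in> T y}. 0 \<le> inner (x - y) (u - v)"
    have "u + w \<in> T x"
    proof (rule maximal_monotoneD[OF T])
      fix y v assume "v \<in> T y"
      then show "0 \<le> inner (x - y) (u + w - v)"
        using rel[rule_format, of "v - w" y] by (simp add: algebra_simps)
    qed
    then show "u \<in> {v. v + w \<in> T x}" by simp
  qed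
  from Minty_zero[OF this] show ?thesis by simp
qed

section \<open>Resolvents and maximality of the sum\<close>

text \<open>Minty's theorem gives existence and monotonicity uniqueness, so the definite description
  in \<open>resolvent\<close> is meaningful.\<close>

lemma resolvent_mem:
  fixes T :: "'a::{real_inner, complete_space} \<Rightarrow> 'a set"
  assumes T: "maximal_monotone T"
  shows "x - resolvent T x \<in> T (resolvent T x)"
proof -
  have inv: "y \<in> op_inverse (op_sum (op_of_map (\<lambda>z. z)) T) x \<longleftrightarrow> x - y \<in> T y" for y
    by (force simp: op_inverse_def op_sum_def op_of_map_def set_plus_def)
  have "\<exists>!y. x - y \<in> T y"
  proof (rule ex_ex1I[OF Minty[OF T]])
    fix y z assume "x - y \<in> T y" "x - z \<in> T z"
    from monotone_opD[OF maximal_monotone_imp_monotone[OF T] this]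
    have "inner (y - z) (y - z) \<le> 0"
      by (simp add: inner_diff_left inner_diff_right)
    then show "y = z"
      by (metis inner_ge_zero inner_eq_zero_iff order_antisym right_minus_eq)
  qed
  from theI'[OF this] show ?thesis
    unfolding resolvent_def inv .
qed

text \<open>Monotonicity gives firm nonexpansiveness; by Cauchy-Schwarz one factor
  \<open>norm ?d\<close> cancels.\<close>

lemma resolvent_nonexpansive:
  fixes T :: "'a::{real_inner, complete_space} \<Rightarrow> 'a set"
  assumes T: "maximal_monotone T"
  shows "dist (resolvent T x) (resolvent T y) \<le> dist x y"
proof -
  let ?d = "resolvent T x - resolvent T y"
  have "(norm ?d)\<^sup>2 \<le> inner ?d (x - y)"
    using monotone_opD[OF maximal_monotone_imp_monotone[OF T] resolvent_mem[OF T] resolvent_mem[OF T], of x y]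
    unfolding power2_norm_eq_inner by (simp add: inner_diff_left inner_diff_right)
  also have "\<dots> \<le> norm ?d * norm (x - y)"
    by (rule norm_cauchy_schwarz)
  finally show ?thesis
    by (cases "?d = 0") (auto simp: dist_norm power2_eq_square)
qed

lemma op_sum_of_map_iff: "u \<in> op_sum (op_of_map A) B x \<longleftrightarrow> u - A x \<in> (B x :: 'a::ab_group_add set)"
proof -
  have "u = A x + b \<longleftrightarrow> b = u - A x" for b
    by (auto simp: algebra_simps)
  then show ?thesis
    by (simp add: op_sum_def op_of_map_def set_plus_def)
qed

text \<open>
  Maximality follows from surjectivity of \<open>I + c(A + B)\<close> for small \<open>c\<close>, and \<open>w\<close> is in the range
  because \<open>x \<mapsto> J\<^bsub>cB\<^esub> (w - c A x)\<close> is a contraction.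
\<close>

lemma maximal_monotone_lipschitz_sum:
  fixes A :: "'a::{real_inner, complete_space} \<Rightarrow> 'a"
  assumes A: "monotone_op (op_of_map A)" "L-lipschitz_on UNIV A" and B: "maximal_monotone B"
  shows "maximal_monotone (op_sum (op_of_map A) B)"
  unfolding maximal_monotone_iff
proof (intro conjI allI impI)
  have "0 \<le> inner (x - y) (u - v)"
    if "u - A x \<in> B x" "v - A y \<in> B y" for x y u v
  proof -
    have "0 \<le> inner (x - y) (A x - A y)"
      using A(1) by (auto simp: monotone_op_def op_of_map_def)
    then show ?thesis
      using monotone_opD[OF maximal_monotone_imp_monotone[OF B] that] by (simp add: inner_diff_right)
  qed
  then show "monotone_op (op_sum (op_of_map A) B)"
    unfolding monotone_op_def op_sum_of_map_iff by blast
next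
  fix z u
  assume rel: "\<forall>y. \<forall>v\<in>op_sum (op_of_map A) B y. 0 \<le> inner (z - y) (u - v)"
  have "0 \<le> L"
    using A(2) by (rule lipschitz_on_nonneg)
  define c where "c = 1 / (L + 1)"
  have c: "0 < c" "c * L < 1" "0 \<le> c * L"
    using \<open>0 \<le> L\<close> by (auto simp: c_def field_simps)
  define J where "J = resolvent (op_scale c B)"
  have cB: "maximal_monotone (op_scale c B)"
    using maximal_monotone_op_scale[OF B c(1)] .
  have "dist (J (z + c *\<^sub>R u - c *\<^sub>R A x)) (J (z + c *\<^sub>R u - c *\<^sub>R A y)) \<le> c * L * dist x y" for x y
  proof -
    have "dist (J (z + c *\<^sub>R u - c *\<^sub>R A x)) (J (z + c *\<^sub>R u - c *\<^sub>R A y))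
        \<le> dist (z + c *\<^sub>R u - c *\<^sub>R A x) (z + c *\<^sub>R u - c *\<^sub>R A y)"
      unfolding J_def by (rule resolvent_nonexpansive[OF cB])
    also have "\<dots> = norm (c *\<^sub>R (A y - A x))"
      by (simp add: dist_norm scaleR_diff_right)
    also have "\<dots> = c * dist (A x) (A y)"
      using c by (simp add: dist_norm norm_minus_commute)
    also have "\<dots> \<le> c * (L * dist x y)"
      using c lipschitz_onD[OF A(2), of x y] by (intro mult_left_mono) auto
    finally show ?thesis by simp
  qed
  then obtain x where x: "J (z + c *\<^sub>R u - c *\<^sub>R A x) = x"
    using banach_fix_type[OF c(3,2), of "\<lambda>x. J (z + c *\<^sub>R u - c *\<^sub>R A x)"] by blast
  have "z + c *\<^sub>R u - c *\<^sub>R A x - x \<in> op_scale c B x"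
    using resolvent_mem[OF cB, of "z + c *\<^sub>R u - c *\<^sub>R A x"] x by (simp add: J_def)
  then obtain b where b: "b \<in> B x" "z + c *\<^sub>R u - c *\<^sub>R A x - x = c *\<^sub>R b"
    by (auto simp: op_scale_def)
  \<comment> \<open>The fixed point makes \<open>z - x\<close> a positive multiple of
    \<open>A x + b - u\<close>, so \<open>rel\<close> says that minus a squared norm is nonnegative;
    hence \<open>u = A x + b\<close> and \<open>z = x\<close>.\<close>
  have "z - x = c *\<^sub>R (A x + b - u)"
    using b(2) by (simp add: algebra_simps)
  moreover have "0 \<le> inner (z - x) (u - (A x + b))"
    using rel b(1) by (auto simp: op_sum_of_map_iff)
  ultimately have "0 \<le> c * inner (A x + b - u) (u - (A x + b))"
    by simp
  then have "0 \<le> inner (A x + b - u) (- (A x + b - u))"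
    using c(1) by (simp add: zero_le_mult_iff)
  then have "inner (A x + b - u) (A x + b - u) \<le> 0"
    unfolding inner_minus_right by linarith
  then have "u = A x + b"
    by (metis inner_ge_zero inner_eq_zero_iff order_antisym right_minus_eq)
  then show "u \<in> op_sum (op_of_map A) B z"
    using \<open>z - x = _\<close> b(1) by (simp add: op_sum_of_map_iff)
qed

section \<open>Bounded and null sequences\<close>

text \<open>The uniform boundedness principle, by Baire: one of the closed sets \<open>C n\<close>
  covering the space contains a ball.\<close>

lemma pointwise_Bseq_inner_imp_Bseq:
  fixes z :: "nat \<Rightarrow> 'a::{real_inner, complete_space}"
  assumes "\<And>x. Bseq (\<lambda>k. inner (z k) x)"
  shows "Bseq z"
proof -
  define C where "C n = {x. \<forall>k. \<bar>inner (z k) x\<bar> \<le> real n}" for n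
  have "closed (C n)" for n
    unfolding C_def by (intro closed_Collect_all closed_Collect_le continuous_intros)
  have "x \<in> (\<Union>n. C n)" for x
  proof -
    obtain K where "\<And>k. norm (inner (z k) x) \<le> K"
      using assms[of x] by (auto simp: Bseq_def)
    moreover obtain n where "K \<le> real n"
      using real_arch_simple by blast
    ultimately have "\<bar>inner (z k) x\<bar> \<le> real n" for k
      by (metis order_trans real_norm_def)
    then show ?thesis
      by (auto simp: C_def)
  qed
  then have "interior (\<Union>(range C)) \<noteq> {}"
    by (metis UNIV_eq_I UNIV_not_empty interior_UNIV)
  then obtain n where "interior (C n) \<noteq> {}"
    using Baire_category_alt[of "euclidean :: 'a topology" "range C"] \<open>\<And>n. closed (C n)\<close>
      completely_metrizable_space_euclidean by auto
  then obtain x r where r: "0 < r" "cball x r \<subseteq> C n"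
    by (metis equals0I mem_interior_cball)
  have "norm (z k) \<le> 2 * real n / r" for k
  proof -
    \<comment> \<open>Moving from the centre by \<open>r\<close> in the direction of
      \<open>z k\<close> changes the inner product by \<open>r * norm (z k)\<close>, while both
      values are at most \<open>n\<close> in modulus.\<close>
    let ?y = "x + r *\<^sub>R sgn (z k)"
    have "?y \<in> C n" "x \<in> C n"
      using r by (auto simp: dist_norm norm_sgn intro!: subsetD[OF r(2)])
    then have "\<bar>inner (z k) ?y\<bar> \<le> n" "\<bar>inner (z k) x\<bar> \<le> n"
      by (auto simp: C_def)
    moreover have "inner (z k) ?y - inner (z k) x = r * norm (z k)"
      by (cases "z k = 0")
        (simp_all add: inner_add_right sgn_div_norm power2_norm_eq_inner[symmetric] power2_eq_square)
    ultimately have "r * norm (z k) \<le> 2 * real n"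
      by linarith
    then show ?thesis
      using r by (simp add: field_simps)
  qed
  then show ?thesis
    by (rule BseqI')
qed

lemma weakly_tendsto_inner: "weakly_tendsto z l \<Longrightarrow> (\<lambda>k. inner (z k) x) \<longlonglongrightarrow> inner l x"
  unfolding weakly_tendsto_def using bounded_linear_inner_left[of x] by blast

lemma weakly_tendsto_imp_Bseq:
  fixes z :: "nat \<Rightarrow> 'a::{real_inner, complete_space}"
  assumes "weakly_tendsto z l"
  shows "Bseq z"
  by (rule pointwise_Bseq_inner_imp_Bseq[OF convergent_imp_Bseq[OF convergentI]])
    (rule weakly_tendsto_inner[OF assms])

text \<open>A positive lower bound on \<open>c\<close> bounds its inverses. In P2 this undoes the
  scaling of \<open>T\<close> in the limit.\<close>

lemma tendsto_zero_divideR: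
  fixes f :: "nat \<Rightarrow> 'a::real_normed_vector"
  assumes "f \<longlonglongrightarrow> 0" "0 < c0" "\<And>k. c0 \<le> c k"
  shows "(\<lambda>k. f k /\<^sub>R c k) \<longlonglongrightarrow> 0"
proof (rule Lim_null_comparison[OF always_eventually])
  show "\<forall>k. norm (f k /\<^sub>R c k) \<le> inverse c0 * norm (f k)"
  proof
    fix k
    have "0 < c k" "inverse (c k) \<le> inverse c0"
      using assms(2) assms(3)[of k] by (auto intro: le_imp_inverse_le)
    then show "norm (f k /\<^sub>R c k) \<le> inverse c0 * norm (f k)"
      by (simp add: mult_right_mono)
  qed
  show "(\<lambda>k. inverse c0 * norm (f k)) \<longlonglongrightarrow> 0"
    using tendsto_mult_right_zero[OF tendsto_norm_zero[OF assms(1)]] .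
qed

section \<open>P1 and P2 for approximate resolvents\<close>

text \<open>Testing the enlargement at the pair \<open>(xs, 0)\<close> bounds
  \<open>inner (y - xs) v\<close> below by \<open>- \<epsilon>\<close>; expanding the squares brings
  in the error term.\<close>

lemma approx_resolvent_decrease:
  assumes "0 \<in> T xs" and v: "v \<in> enlargement \<epsilon> T y"
    and err: "(norm (v + y - x))\<^sup>2 + 2 * \<epsilon> \<le> \<sigma>\<^sup>2 * (norm (y - x))\<^sup>2"
  shows "(1 - \<sigma>\<^sup>2) * (norm (y - x))\<^sup>2 \<le> (norm (xs - x))\<^sup>2 - (norm (xs - (x - v)))\<^sup>2"
proof -
  have "- \<epsilon> \<le> inner (y - xs) v"
    using v assms(1) unfolding enlargement_def by fastforce
  moreover have "(norm (xs - x))\<^sup>2 - (norm (xs - (x - v)))\<^sup>2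
      = 2 * inner (y - xs) v + (norm (y - x))\<^sup>2 - (norm (v + y - x))\<^sup>2"
    unfolding power2_norm_eq_inner by (simp add: algebra_simps inner_commute)
  ultimately show ?thesis
    using err by (simp add: algebra_simps)
qed

lemma zero_mem_op_scale: "0 \<in> T x \<Longrightarrow> 0 \<in> op_scale c T x"
  unfolding op_scale_def by force

lemma property_P1_approx_resolvent:
  assumes "\<bar>\<sigma>\<bar> \<le> 1"
  shows "property_P1 (\<lambda>n. approx_resolvent (op_scale (c n) T) \<sigma>) (op_inverse T 0)"
  unfolding property_P1_def
proof (intro allI impI)
  fix n x x' xs
  assume "x' \<in> approx_resolvent (op_scale (c n) T) \<sigma> x" and "xs \<in> op_inverse T 0"
  then have "0 \<in> op_scale (c n) T xs"
    by (simp add: op_inverse_def zero_mem_op_scale)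
  moreover obtain v \<epsilon> y where "x' = x - v" "v \<in> enlargement \<epsilon> (op_scale (c n) T) y"
    "(norm (v + y - x))\<^sup>2 + 2 * \<epsilon> \<le> \<sigma>\<^sup>2 * (norm (y - x))\<^sup>2"
    using \<open>x' \<in> _\<close> unfolding approx_resolvent_def by blast
  ultimately have "(1 - \<sigma>\<^sup>2) * (norm (y - x))\<^sup>2 \<le> (norm (xs - x))\<^sup>2 - (norm (xs - x'))\<^sup>2"
    using approx_resolvent_decrease by blast
  moreover have "0 \<le> (1 - \<sigma>\<^sup>2) * (norm (y - x))\<^sup>2"
    using assms by (simp add: abs_square_le_1)
  ultimately have "(norm (xs - x'))\<^sup>2 \<le> (norm (xs - x))\<^sup>2"
    by linarith
  then show "norm (xs - x') \<le> norm (xs - x)"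
    by (rule power2_le_imp_le) simp
qed

lemma property_P2_approx_resolvent:
  fixes T :: "'a::{real_inner, complete_space} \<Rightarrow> 'a set"
  assumes T: "maximal_monotone T" and "\<bar>\<sigma>\<bar> < 1" and "0 < c0" and c: "\<And>n. c0 \<le> c n"
  shows "property_P2 (\<lambda>n. approx_resolvent (op_scale (c n) T) \<sigma>) (op_inverse T 0)"
  unfolding property_P2_def
proof (intro allI impI, elim bexE)
  fix z zbar z' n xs
  assume weak: "weakly_tendsto z zbar"
    and z': "\<forall>k. z' k \<in> approx_resolvent (op_scale (c (n k)) T) \<sigma> (z k)"
    and xs: "xs \<in> op_inverse T 0"
    and lim: "(\<lambda>k. norm (xs - z k) - norm (xs - z' k)) \<longlonglongrightarrow> 0"
  have zero: "0 \<in> op_scale (c (n k)) T xs" for k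
    using xs by (simp add: op_inverse_def zero_mem_op_scale)
  have "\<forall>k. \<exists>v \<epsilon> y. z' k = z k - v \<and> 0 \<le> \<epsilon> \<and> v \<in> enlargement \<epsilon> (op_scale (c (n k)) T) y
      \<and> (norm (v + y - z k))\<^sup>2 + 2 * \<epsilon> \<le> \<sigma>\<^sup>2 * (norm (y - z k))\<^sup>2"
    using z' unfolding approx_resolvent_def by blast
  then obtain v \<epsilon> y where z'_eq: "\<And>k. z' k = z k - v k" and \<epsilon>: "\<And>k. 0 \<le> \<epsilon> k"
    and v: "\<And>k. v k \<in> enlargement (\<epsilon> k) (op_scale (c (n k)) T) (y k)"
    and err: "\<And>k. (norm (v k + y k - z k))\<^sup>2 + 2 * \<epsilon> k \<le> \<sigma>\<^sup>2 * (norm (y k - z k))\<^sup>2"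
    by metis
  have "\<sigma>\<^sup>2 < 1"
    using assms(2) by (simp add: abs_square_less_1)
  obtain Kz where "\<And>k. norm (z k) \<le> Kz"
    using weakly_tendsto_imp_Bseq[OF weak] by (auto simp: Bseq_def)
  then have K: "norm (xs - z k) \<le> norm xs + Kz" for k
    by (meson add_left_mono norm_triangle_ineq4 order_trans)
  define K where "K = norm xs + Kz"
  note K = K[folded K_def]
  \<comment> \<open>The decrease estimate bounds a difference of squares; factoring it and bounding
    the sum of the norms by \<open>2 * K\<close> leaves the difference of norms, which tends to
    0.\<close>
  have diff_le: "(norm (y k - z k))\<^sup>2
      \<le> 2 * K / (1 - \<sigma>\<^sup>2) * \<bar>norm (xs - z k) - norm (xs - z' k)\<bar>" for k
  proof -
    let ?d = "norm (xs - z k)" and ?e = "norm (xs - z' k)"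
    have le: "(1 - \<sigma>\<^sup>2) * (norm (y k - z k))\<^sup>2 \<le> ?d\<^sup>2 - ?e\<^sup>2"
      using approx_resolvent_decrease[OF zero v err] z'_eq by simp
    moreover have "0 \<le> (1 - \<sigma>\<^sup>2) * (norm (y k - z k))\<^sup>2"
      using \<open>\<sigma>\<^sup>2 < 1\<close> by simp
    ultimately have "?e\<^sup>2 \<le> ?d\<^sup>2"
      by linarith
    then have "?e \<le> ?d"
      by (rule power2_le_imp_le) simp
    note le
    also have "?d\<^sup>2 - ?e\<^sup>2 = (?d + ?e) * (?d - ?e)"
      by (simp add: power2_eq_square algebra_simps)
    also have "\<dots> \<le> (2 * K) * \<bar>?d - ?e\<bar>"
      using \<open>?e \<le> ?d\<close> K[of k] order_trans[OF norm_ge_zero K] by (intro mult_mono) auto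
    finally show ?thesis
      using \<open>\<sigma>\<^sup>2 < 1\<close> by (simp add: field_simps)
  qed
  have "(\<lambda>k. 2 * K / (1 - \<sigma>\<^sup>2) * \<bar>norm (xs - z k) - norm (xs - z' k)\<bar>) \<longlonglongrightarrow> 0"
    using tendsto_mult_right_zero[OF tendsto_rabs_zero[OF lim]] .
  then have sq: "(\<lambda>k. (norm (y k - z k))\<^sup>2) \<longlonglongrightarrow> 0"
    by (rule Lim_null_comparison[rotated]) (use diff_le in simp)
  then have yz: "(\<lambda>k. y k - z k) \<longlonglongrightarrow> 0"
    using tendsto_real_sqrt[OF sq] by (simp add: tendsto_norm_zero_iff)
  have shrink: "\<sigma>\<^sup>2 * (norm (y k - z k))\<^sup>2 \<le> (norm (y k - z k))\<^sup>2" for k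
    using \<open>\<sigma>\<^sup>2 < 1\<close> by (intro mult_left_le_one_le) auto
  have \<epsilon>0: "\<epsilon> \<longlonglongrightarrow> 0"
  proof (rule Lim_null_comparison[OF always_eventually sq], intro allI)
    fix k
    have "2 * \<epsilon> k \<le> (norm (y k - z k))\<^sup>2"
      using err[of k] shrink[of k] zero_le_power2[of "norm (v k + y k - z k)"] by linarith
    then show "norm (\<epsilon> k) \<le> (norm (y k - z k))\<^sup>2"
      using \<epsilon>[of k] by simp
  qed
  have v0: "v \<longlonglongrightarrow> 0"
  proof (rule Lim_null_comparison)
    show "\<forall>\<^sub>F k in sequentially. norm (v k) \<le> 2 * norm (y k - z k)"
    proof (intro always_eventually allI)
      fix k
      have "(norm (v k + y k - z k))\<^sup>2 \<le> (norm (y k - z k))\<^sup>2"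
        using err[of k] \<epsilon>[of k] shrink[of k] by linarith
      then have "norm (v k + y k - z k) \<le> norm (y k - z k)"
        by (rule power2_le_imp_le) simp
      then show "norm (v k) \<le> 2 * norm (y k - z k)"
        using norm_triangle_ineq4[of "v k + y k - z k" "y k - z k"] by simp
    qed
    show "(\<lambda>k. 2 * norm (y k - z k)) \<longlonglongrightarrow> 0"
      using tendsto_mult_right_zero[OF tendsto_norm_zero[OF yz]] .
  qed
  have "0 \<in> T zbar"
  proof (rule maximal_monotoneD[OF T])
    fix a b assume "b \<in> T a"
    \<comment> \<open>The enlargement inequality at \<open>c (n k) *\<^sub>R b\<close>, divided by
      \<open>c (n k)\<close>.\<close>
    have lower: "- (\<epsilon> k /\<^sub>R c (n k)) \<le> inner (y k - a) (v k /\<^sub>R c (n k)) - inner (y k - a) b" for k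
    proof -
      have "0 < c (n k)"
        using assms(3) c[of "n k"] by linarith
      have "- \<epsilon> k \<le> inner (y k - a) (v k - c (n k) *\<^sub>R b)"
        using v[of k] \<open>b \<in> T a\<close> by (auto simp: enlargement_def op_scale_def)
      then show ?thesis
        using \<open>0 < c (n k)\<close> by (simp add: inner_diff_right field_simps)
    qed
    \<comment> \<open>Weak convergence suffices here because \<open>b\<close> is fixed and
      \<open>y k - z k\<close> tends to 0 in norm.\<close>
    have yb: "(\<lambda>k. inner (y k - a) b) \<longlonglongrightarrow> inner (zbar - a) b"
    proof -
      have "(\<lambda>k. inner (y k - z k) b + inner (z k) b - inner a b) \<longlonglongrightarrow> inner 0 b + inner zbar b - inner a b"
        by (intro tendsto_intros yz weakly_tendsto_inner[OF weak])
      then show ?thesis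
        by (simp add: inner_diff_left)
    qed
    have "Bseq (\<lambda>k. y k - z k)"
      using yz by (intro convergent_imp_Bseq convergentI)
    then obtain M where M: "\<And>k. norm (y k - z k) \<le> M"
      by (auto simp: Bseq_def)
    have ya: "norm (y k - a) \<le> M + K + norm (xs - a)" for k
    proof -
      have "y k - a = (y k - z k) - (xs - z k) + (xs - a)" by simp
      then have "norm (y k - a) \<le> norm ((y k - z k) - (xs - z k)) + norm (xs - a)"
        by (metis norm_triangle_ineq)
      then show ?thesis
        using norm_triangle_ineq4[of "y k - z k" "xs - z k"] M[of k] K[of k] by linarith
    qed
    \<comment> \<open>Both factors vary with \<open>k\<close>, so the limit is taken by bounding
      \<open>y k - a\<close> while the scaled \<open>v k\<close> tends to 0 in norm.\<close>
    have bound: "norm (inner (y k - a) (v k /\<^sub>R c (n k))) \<le> (M + K + norm (xs - a)) * norm (v k /\<^sub>R c (n k))" for k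
      unfolding real_norm_def by (rule order_trans[OF Cauchy_Schwarz_ineq2 mult_right_mono[OF ya norm_ge_zero]])
    have "(\<lambda>k. inner (y k - a) (v k /\<^sub>R c (n k))) \<longlonglongrightarrow> 0"
      using tendsto_mult_right_zero[OF tendsto_norm_zero[OF tendsto_zero_divideR[OF v0 assms(3) c]]]
      by (rule Lim_null_comparison[OF always_eventually[OF allI[OF bound]]])
    then have "(\<lambda>k. inner (y k - a) (v k /\<^sub>R c (n k)) - inner (y k - a) b) \<longlonglongrightarrow> 0 - inner (zbar - a) b"
      using yb by (rule tendsto_diff)
    with tendsto_minus[OF tendsto_zero_divideR[OF \<epsilon>0 assms(3) c, of n]] have "- 0 \<le> 0 - inner (zbar - a) b"
      by (rule LIMSEQ_le) (use lower in blast)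
    then show "0 \<le> inner (zbar - a) (0 - b)"
      by (simp add: inner_diff_right)
  qed
  then show "zbar \<in> op_inverse T 0"
    by (simp add: op_inverse_def)
qed

section \<open>Tseng's method\<close>

text \<open>P1 constrains every value of the maps, so it passes to maps with smaller values; this
  and its P2 analogue reduce the claims for Tseng's maps to an inclusion.\<close>

lemma property_P1_mono:
  "property_P1 F \<Omega> \<Longrightarrow> (\<And>n x. G n x \<subseteq> F n x) \<Longrightarrow> property_P1 G \<Omega>"
  unfolding property_P1_def by blast

lemma property_P2_mono:
  "property_P2 F \<Omega> \<Longrightarrow> (\<And>n x. G n x \<subseteq> F n x) \<Longrightarrow> property_P2 G \<Omega>"
  unfolding property_P2_def by blast

lemma tseng_step_mem_approx_resolvent:
  fixes A :: "'a::{real_inner, complete_space} \<Rightarrow> 'a"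
  assumes mono: "monotone_op (op_of_map A)" and A: "L-lipschitz_on UNIV A"
    and B: "maximal_monotone B" and l: "0 < l" "l * L \<le> \<sigma>"
  shows "(tseng_G A l \<circ> tseng_H A B l) x \<in> approx_resolvent (op_scale l (op_sum (op_of_map A) B)) \<sigma> x"
proof -
  let ?T = "op_sum (op_of_map A) B"
  define y where "y = resolvent (op_scale l B) (x - l *\<^sub>R A x)"
  define v where "v = x - y + l *\<^sub>R (A y - A x)"
  have "x - l *\<^sub>R A x - y \<in> op_scale l B y"
    unfolding y_def by (rule resolvent_mem[OF maximal_monotone_op_scale[OF B l(1)]])
  then obtain b where b: "b \<in> B y" "x - l *\<^sub>R A x - y = l *\<^sub>R b"
    by (auto simp: op_scale_def)
  have T: "monotone_op (op_scale l ?T)"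
    by (intro maximal_monotone_imp_monotone maximal_monotone_op_scale maximal_monotone_lipschitz_sum[OF mono A B] l)
  have "v = l *\<^sub>R (A y + b)"
    using b(2) by (simp add: v_def algebra_simps)
  then have "v \<in> op_scale l ?T y"
    using b(1) by (auto simp: op_scale_def op_sum_of_map_iff)
  \<comment> \<open>By monotonicity, values of an operator lie in its enlargement with \<epsilon> =
    0.\<close>
  then have "v \<in> enlargement 0 (op_scale l ?T) y"
    using monotone_opD[OF T] by (simp add: enlargement_def)
  moreover have "norm (v + y - x) \<le> \<sigma> * norm (y - x)"
  proof -
    have "norm (v + y - x) = l * dist (A y) (A x)"
      using l(1) by (simp add: v_def dist_norm)
    also have "\<dots> \<le> l * (L * dist y x)"
      using l(1) lipschitz_onD[OF A, of y x] by (intro mult_left_mono) auto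
    also have "\<dots> \<le> \<sigma> * norm (y - x)"
      using mult_right_mono[OF l(2), of "norm (y - x)"] by (simp add: dist_norm)
    finally show ?thesis .
  qed
  then have "(norm (v + y - x))\<^sup>2 + 2 * 0 \<le> \<sigma>\<^sup>2 * (norm (y - x))\<^sup>2"
    using power_mono[of "norm (v + y - x)" "\<sigma> * norm (y - x)" 2] by (simp add: power_mult_distrib)
  moreover have "(tseng_G A l \<circ> tseng_H A B l) x = x - v"
    by (simp add: tseng_G_def tseng_H_def v_def y_def)
  ultimately show ?thesis
    unfolding approx_resolvent_def by blast
qed

theorem corollary6p2:
  fixes A :: "'a::{real_inner, complete_space} \<Rightarrow> 'a"
    and B :: "'a \<Rightarrow> 'a set"
    and L lam_lo lam_hi \<sigma> :: real
    and lam :: "nat \<Rightarrow> real"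
    and x y :: "nat \<Rightarrow> 'a"
  assumes "L > 0"
    and "monotone_op (op_of_map A)"
    and "L-lipschitz_on UNIV A"
    and "maximal_monotone B"
    and "0 < lam_lo" "lam_lo \<le> lam_hi" "lam_hi < 1 / L"
    and "\<forall>k\<ge>1. lam k \<in> {lam_lo..lam_hi}"
    and "\<forall>k\<ge>1. y k = resolvent (op_scale (lam k) B) (x (k - 1) - lam k *\<^sub>R A (x (k - 1)))"
    and "\<forall>k\<ge>1. x k = y k - lam k *\<^sub>R (A (y k) - A (x (k - 1)))"
    and "\<sigma> = lam_hi * L"
  shows "0 < \<sigma> \<and> \<sigma> < 1
    \<and> (\<forall>w. \<forall>k\<ge>1. (tseng_G A (lam k) \<circ> tseng_H A B (lam k)) w
            \<in> approx_resolvent (op_scale (lam k) (op_sum (op_of_map A) B)) \<sigma> w)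
    \<and> (\<forall>k\<ge>1. x k = (tseng_G A (lam k) \<circ> tseng_H A B (lam k)) (x (k - 1))
          \<and> x k \<in> approx_resolvent (op_scale (lam k) (op_sum (op_of_map A) B)) \<sigma> (x (k - 1)))
    \<and> property_P1 (\<lambda>n. op_of_map (tseng_G A (lam (Suc n)) \<circ> tseng_H A B (lam (Suc n))))
        (op_inverse (op_sum (op_of_map A) B) 0)
    \<and> property_P2 (\<lambda>n. op_of_map (tseng_G A (lam (Suc n)) \<circ> tseng_H A B (lam (Suc n))))
        (op_inverse (op_sum (op_of_map A) B) 0)"
proof -
  let ?T = "op_sum (op_of_map A) B"
  let ?F = "\<lambda>k. tseng_G A (lam k) \<circ> tseng_H A B (lam k)"
  have \<sigma>: "0 < \<sigma>" "\<sigma> < 1"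
    using assms(1,5-7,11) by (auto simp: field_simps)
  have lam: "0 < lam k" "lam_lo \<le> lam k" "lam k * L \<le> \<sigma>" if "1 \<le> k" for k
    using assms(1,5,8,11) that by (auto simp: mult_right_mono dest!: spec[of _ k])
  have step: "?F k w \<in> approx_resolvent (op_scale (lam k) ?T) \<sigma> w" if "1 \<le> k" for k w
    using tseng_step_mem_approx_resolvent[OF assms(2-4) lam(1,3)[OF that]] .
  have x_eq: "x k = ?F k (x (k - 1))" if "1 \<le> k" for k
    using assms(9,10) that by (simp add: tseng_G_def tseng_H_def)
  \<comment> \<open>The properties index maps from 0 but the step sizes are controlled only from 1,
    hence the shift by \<open>Suc\<close>.\<close>
  have sub: "op_of_map (?F (Suc n)) w \<subseteq> approx_resolvent (op_scale (lam (Suc n)) ?T) \<sigma> w" for n w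
    using step[of "Suc n"] by (simp add: op_of_map_def)
  have "property_P1 (\<lambda>n. op_of_map (?F (Suc n))) (op_inverse ?T 0)"
    using \<sigma> by (intro property_P1_mono[OF property_P1_approx_resolvent sub]) simp
  moreover have "property_P2 (\<lambda>n. op_of_map (?F (Suc n))) (op_inverse ?T 0)"
    using \<sigma> lam(2)
    by (intro property_P2_mono[OF property_P2_approx_resolvent[OF
          maximal_monotone_lipschitz_sum[OF assms(2-4)] _ assms(5)] sub]) auto
  moreover have "\<forall>k\<ge>1. x k = ?F k (x (k - 1))
      \<and> x k \<in> approx_resolvent (op_scale (lam k) ?T) \<sigma> (x (k - 1))"
    using step x_eq by (metis (no_types, lifting))
  ultimately show ?thesis
    using \<sigma> step by blast
qed

end
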